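(* Let $\mu$ be a finite positive Borel measure on the interval $[0,1)$. If $\alpha>1$ and $0<\beta<\alpha+1$, then $\mathcal{C}_\mu:\mathcal{B}^{\alpha}\to\mathcal{B}^{\beta}$ is bounded if and only if $\mu$ is an $(\alpha+1-\beta)$-Carleson measure.
   Context: Let $\mathbb{D}=\{z\in\mathbb{C}:|z|<1\}$ and let $H(\mathbb{D})$ be the space of all analytic functions in $\mathbb{D}$. For $0<\alpha<\infty$, the Bloch-type space is $\mathcal{B}^{\alpha}=\{f\in H(\mathbb{D}):\|f\|_{\mathcal{B}^\alpha}=|f(0)|+\sup_{z\in\mathbb{D}}(1-|z|^2)^{\alpha}|f'(z)|<\infty\}$. For a finite positive Borel measure $\mu$ on $[0,1)$ and $f(z)=\sum_{n=0}^\infty a_nz^n\in H(\mathbb{D})$, the Cesàro-like operator is $$\mathcal{C}_\mu(f)(z)=\sum_{n=0}^\infty\left(\mu_n\sum_{k=0}^n a_k\right)z^n=\int_{[0,1)}\frac{f(tz)}{1-tz}\,d\mu(t),\quad z\in\mathbb{D},$$ where $\mu_n=\int_{[0,1)}t^n\,d\mu(t)$. For $0<s<\infty$, a positive Borel measure $\nu$ on $\mathbb{D}$ is an $s$-Carleson measure if $\sup_{I\subset\partial\mathbb{D}}\nu(S(I))/|I|^s<\infty$, where $I$ ranges over arcs, $|I|$ is the length of $I$, and $S(I)=\{re^{i\vartheta}:e^{i\vartheta}\in I,\ 1-\frac{|I|}{2\pi}\le r<1\}$. A measure $\mu$ on $[0,1)$ is regarded as a measure on $\mathbb{D}$ via $\overline{\mu}(E)=\mu(E\cap[0,1))$;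 thus $\mu$ is an $s$-Carleson measure if and only if there is a constant $M>0$ with $\mu([t,1))\le M(1-t)^s$ for all $0\le t<1$. *)

theory Defs
  imports "HOL-Complex_Analysis.Complex_Analysis"
begin

text \<open>
  Functions on the open unit disc are represented by total functions
  \<^typ>\<open>complex \<Rightarrow> complex\<close>; the notions below that concern such functions only depend on
  the values on \<^term>\<open>ball (0::complex) 1\<close>.
\<close>

definition bloch :: "real \<Rightarrow> (complex \<Rightarrow> complex) set" where
  "bloch \<alpha> = {f. f holomorphic_on ball 0 1 \<and>
     bdd_above ((\<lambda>z. (1 - (cmod z)\<^sup>2) powr \<alpha> * cmod (deriv f z)) ` ball 0 1)}"

text \<open>The real supremum is meaningful only for members of \<^term>\<open>bloch \<alpha>\<close>.\<close>

definition bloch_norm :: "real \<Rightarrow> (complex \<Rightarrow> complex) \<Rightarrow> real" where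
  "bloch_norm \<alpha> f =
     cmod (f 0) + (SUP z\<in>ball 0 1. (1 - (cmod z)\<^sup>2) powr \<alpha> * cmod (deriv f z))"

definition bounded_bloch_operator ::
    "real \<Rightarrow> real \<Rightarrow> ((complex \<Rightarrow> complex) \<Rightarrow> (complex \<Rightarrow> complex)) \<Rightarrow> bool" where
  "bounded_bloch_operator \<alpha> \<beta> T \<longleftrightarrow>
     (\<forall>f\<in>bloch \<alpha>. T f \<in> bloch \<beta>) \<and>
     (\<exists>C. \<forall>f\<in>bloch \<alpha>. bloch_norm \<beta> (T f) \<le> C * bloch_norm \<alpha> f)"

definition moment :: "real measure \<Rightarrow> nat \<Rightarrow> real" where
  "moment \<mu> n = (LINT t|\<mu>. t ^ n)"

definition cesaro_like :: "real measure \<Rightarrow> (complex \<Rightarrow> complex) \<Rightarrow> complex \<Rightarrow> complex" where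
  "cesaro_like \<mu> f z =
     (\<Sum>n. complex_of_real (moment \<mu> n) * (\<Sum>k\<le>n. fps_nth (fps_expansion f 0) k) * z ^ n)"

text \<open>
  \<^term>\<open>circle_arc I l\<close>: the set \<^term>\<open>I\<close> is a nondegenerate arc of the unit circle of length
  \<^term>\<open>l\<close>. Each endpoint may or may not belong to the arc, and the full circle is an arc.
\<close>

definition circle_arc :: "complex set \<Rightarrow> real \<Rightarrow> bool" where
  "circle_arc I l \<longleftrightarrow> 0 < l \<and> l \<le> 2 * pi \<and>
     (\<exists>a J. {a<..<a + l} \<subseteq> J \<and> J \<subseteq> {a..a + l} \<and> I = cis ` J)"

definition carleson_box :: "complex set \<Rightarrow> real \<Rightarrow> complex set" where
  "carleson_box I l =
     {complex_of_real r * w | r w. w \<in> I \<and> 1 - l / (2 * pi) \<le> r \<and> r < 1}"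

definition carleson_measure :: "real \<Rightarrow> complex measure \<Rightarrow> bool" where
  "carleson_measure s \<nu> \<longleftrightarrow> sets \<nu> = sets (restrict_space borel (ball 0 1)) \<and>
     (SUP (I, l) \<in> {(I, l). circle_arc I l}.
        emeasure \<nu> (carleson_box I l) / ennreal (l powr s)) < \<infinity>"

text \<open>A Borel measure on \<open>[0,1)\<close>, regarded as a measure on the disc.\<close>

definition disc_measure :: "real measure \<Rightarrow> complex measure" where
  "disc_measure \<mu> = distr \<mu> (restrict_space borel (ball 0 1)) complex_of_real"

lemma emeasure_disc_measure:
  assumes "sets \<mu> = sets (restrict_space borel {0..<1::real})"
    and "E \<in> sets (restrict_space borel (ball (0::complex) 1))"
  shows "emeasure (disc_measure \<mu>) E = emeasure \<mu> {t \<in> {0..<1}. complex_of_real t \<in> E}"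
proof -
  have sp: "space \<mu> = {0..<1}"
    using sets_eq_imp_space_eq[OF assms(1)] by (simp add: space_restrict_space)
  have "complex_of_real \<in> restrict_space borel {0..<1::real} \<rightarrow>\<^sub>M restrict_space borel (ball 0 1)"
    by (intro measurable_restrict_space3 borel_measurable_of_real measurable_ident_sets) (simp_all add: Pi_iff)
  then have "complex_of_real \<in> \<mu> \<rightarrow>\<^sub>M restrict_space borel (ball 0 1)"
    by (simp only: measurable_cong_sets[OF assms(1) refl])
  then have "emeasure (disc_measure \<mu>) E = emeasure \<mu> (complex_of_real -` E \<inter> space \<mu>)"
    unfolding disc_measure_def using assms(2) by (rule emeasure_distr)
  also have "complex_of_real -` E \<inter> space \<mu> = {t \<in> {0..<1}. complex_of_real t \<in> E}"
    unfolding sp by blast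
  finally show ?thesis .
qed

end

(* The operator is the average of dilates: C f(z) = int g(tz) dmu(t) with g(w) = f(w)/(1-w).

   Sufficiency: for f in the alpha-Bloch space with alpha > 1, integrating f' along the radius
   gives |f(w)| <= c (1-|w|)^(1-alpha), so |g'(w)| <= c' (1-|w|)^(-alpha-1) using only
   |1-w| >= 1-|w|. Averaging this bound against a measure with mu[t,1) <= M (1-t)^(alpha+1-beta)
   produces (1-|z|)^(-beta).

   Necessity: one function suffices. For f(w) = (1-w)^(1-alpha), the derivative of C f at
   x in [1/2,1) is alpha * int t (1-tx)^(-alpha-1) dmu(t), which is at least a constant times
   (1-x)^(-alpha-1) mu[x,1), because 1 - tx <= 2 (1-x) for t in [x,1). *)

theory Submission
  imports Defs
begin

section \<open>Pointwise estimates in Bloch-type spaces\<close>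

lemma ereal_less_of_one_le: "ereal a < R" if "a < 1" "1 \<le> R"
  using that by (metis ereal_less(3) less_le_trans)

lemma one_minus_sq_powr_le:
  assumes "0 \<le> x" "x < 1" "0 \<le> (b::real)"
  shows "(1 - x\<^sup>2) powr b \<le> 2 powr b * (1 - x) powr b"
proof -
  have "(1 - x\<^sup>2) powr b = ((1 + x) * (1 - x)) powr b"
    by (simp add: power2_eq_square algebra_simps)
  also have "\<dots> \<le> (2 * (1 - x)) powr b"
    using assms by (intro powr_mono2 mult_right_mono mult_nonneg_nonneg) auto
  also have "\<dots> = 2 powr b * (1 - x) powr b" using assms by (simp only: powr_mult)
  finally show ?thesis .
qed

text \<open>Since 1 - |z|^2 = (1 + |z|)(1 - |z|) lies below 2 (1 - |z|), the simpler weight 1 - |z|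
  costs only the factor \<open>2 powr \<beta>\<close>. This is how membership in a Bloch space is
  proved, both for the test function and for the images under the operator.\<close>

lemma bloch_normI:
  assumes hol: "f holomorphic_on ball 0 1" and b: "0 < \<beta>"
    and bound: "\<And>z. norm z < 1 \<Longrightarrow> norm (deriv f z) \<le> D * (1 - norm z) powr - \<beta>"
  shows "f \<in> bloch \<beta>" and "bloch_norm \<beta> f \<le> norm (f 0) + 2 powr \<beta> * D"
proof -
  have le: "(1 - (cmod z)\<^sup>2) powr \<beta> * cmod (deriv f z) \<le> 2 powr \<beta> * D" if "z \<in> ball 0 1" for z
  proof -
    have z: "norm z < 1" using that by simp
    have "(1 - (cmod z)\<^sup>2) powr \<beta> * cmod (deriv f z)
        \<le> (2 powr \<beta> * (1 - cmod z) powr \<beta>) * (D * (1 - cmod z) powr - \<beta>)"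
      using z b by (intro mult_mono one_minus_sq_powr_le bound) auto
    also have "\<dots> = 2 powr \<beta> * D"
      using z by (simp add: powr_minus field_simps)
    finally show ?thesis .
  qed
  then show "f \<in> bloch \<beta>" using hol unfolding bloch_def by (auto intro!: bdd_aboveI2)
  show "bloch_norm \<beta> f \<le> norm (f 0) + 2 powr \<beta> * D"
    unfolding bloch_norm_def by (intro add_left_mono cSUP_least le) auto
qed

lemma bloch_holomorphic: "f \<in> bloch \<alpha> \<Longrightarrow> f holomorphic_on ball 0 1"
  by (simp add: bloch_def)

lemma bloch_weighted_deriv_le:
  assumes "f \<in> bloch \<alpha>" "norm z < 1"
  shows "(1 - (cmod z)\<^sup>2) powr \<alpha> * cmod (deriv f z) \<le> bloch_norm \<alpha> f - norm (f 0)"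
  using assms cSUP_upper[of z "ball 0 1" "\<lambda>z. (1 - (cmod z)\<^sup>2) powr \<alpha> * cmod (deriv f z)"]
  unfolding bloch_norm_def bloch_def by simp

lemma norm_0_le_bloch_norm: "f \<in> bloch \<alpha> \<Longrightarrow> norm (f 0) \<le> bloch_norm \<alpha> f"
  \<comment> \<open>The supremum is nonnegative because it dominates the weighted derivative at
    0.\<close>
  using order.trans[OF mult_nonneg_nonneg bloch_weighted_deriv_le[of f \<alpha> 0]] by simp

lemma bloch_norm_nonneg: "f \<in> bloch \<alpha> \<Longrightarrow> 0 \<le> bloch_norm \<alpha> f"
  using norm_0_le_bloch_norm norm_ge_zero order_trans by blast

lemma bloch_deriv_le:
  assumes f: "f \<in> bloch \<alpha>" and a: "0 \<le> \<alpha>" and z: "norm z < 1"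
  shows "norm (deriv f z) \<le> bloch_norm \<alpha> f * (1 - norm z) powr - \<alpha>"
proof -
  have "1 - norm z \<le> 1 - (norm z)\<^sup>2"
    using z by (simp add: power2_eq_square mult_left_le_one_le)
  then have "(1 - norm z) powr \<alpha> * norm (deriv f z) \<le> (1 - (norm z)\<^sup>2) powr \<alpha> * norm (deriv f z)"
    using z a by (intro mult_right_mono powr_mono2) auto
  also have "\<dots> \<le> bloch_norm \<alpha> f"
    using bloch_weighted_deriv_le[OF f z] norm_ge_zero[of "f 0"] by linarith
  finally show ?thesis using z by (simp add: powr_minus field_simps)
qed

text \<open>Integrating the bound on f' along the radius gives the factor 1/(\<alpha> - 1). The
  constant term f(0) contributes one more \<open>bloch_norm\<close>, and 1/(\<alpha> - 1) + 1 =
  \<alpha>/(\<alpha> - 1).\<close>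

lemma bloch_growth:
  assumes f: "f \<in> bloch \<alpha>" and a: "1 < \<alpha>" and z: "norm z < 1"
  shows "norm (f z) \<le> (\<alpha> / (\<alpha> - 1)) * bloch_norm \<alpha> f * (1 - norm z) powr (1 - \<alpha>)"
proof -
  let ?N = "bloch_norm \<alpha> f"
  have N: "0 \<le> ?N" by (rule bloch_norm_nonneg[OF f])
  \<comment> \<open>\<open>?\<phi>\<close> is an antiderivative of the bound N |z| (1 -
    t|z|)^(-\<alpha>) for the speed of the path \<open>?h\<close> from f(0) to f(z).\<close>
  let ?h = "\<lambda>t. f (of_real t * z)" and ?\<phi> = "\<lambda>t. ?N / (\<alpha> - 1) * (1 - t * norm z) powr (1 - \<alpha>)"
  have tz: "t * norm z < 1" if "t \<in> {0..1}" for t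
    using that z mult_left_le_one_le[of "norm z" t] by auto
  have ntz: "norm (of_real t * z) = t * norm z" if "t \<in> {0..1}" for t
    using that by (simp add: norm_mult)
  have dh: "(?h has_vector_derivative z * deriv f (of_real t * z)) (at t)" if "t \<in> {0..1}" for t
  proof -
    have "(f has_field_derivative deriv f (of_real t * z)) (at (of_real t * z))"
      using tz[OF that] ntz[OF that] bloch_holomorphic[OF f]
      by (intro holomorphic_derivI[of f "ball 0 1"]) auto
    moreover have "((\<lambda>t. of_real t * z) has_vector_derivative z) (at t)"
      by (auto intro!: derivative_eq_intros)
    ultimately show ?thesis
      using field_vector_diff_chain_at[of "\<lambda>t. of_real t * z" z t f] by (simp add: o_def)
  qed
  have d\<phi>: "(?\<phi> has_real_derivative ?N * norm z * (1 - t * norm z) powr - \<alpha>) (at t)"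
    if "t \<in> {0..1}" for t
  proof (rule DERIV_cong)
    show "(?\<phi> has_real_derivative ?N / (\<alpha> - 1) * ((1 - \<alpha>) * (1 - t * norm z) powr (1 - \<alpha> - 1) * - norm z)) (at t)"
      using tz[OF that] a by (auto intro!: derivative_eq_intros)
    show "?N / (\<alpha> - 1) * ((1 - \<alpha>) * (1 - t * norm z) powr (1 - \<alpha> - 1) * - norm z)
        = ?N * norm z * (1 - t * norm z) powr - \<alpha>"
      using a by (simp add: divide_simps) (simp add: algebra_simps)
  qed
  have "norm (?h 1 - ?h 0) \<le> ?\<phi> 1 - ?\<phi> 0"
  proof (rule differentiable_bound_general)
    show "continuous_on {0..1} ?h"
      by (intro continuous_at_imp_continuous_on ballI has_vector_derivative_continuous[OF dh])
    show "continuous_on {0..1} ?\<phi>"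
      by (intro continuous_at_imp_continuous_on ballI DERIV_isCont[OF d\<phi>])
    fix t :: real assume "0 < t" "t < 1"
    then have t: "t \<in> {0..1}" by simp
    show "(?h has_vector_derivative z * deriv f (of_real t * z)) (at t)" by (rule dh[OF t])
    show "(?\<phi> has_vector_derivative ?N * norm z * (1 - t * norm z) powr - \<alpha>) (at t)"
      using d\<phi>[OF t] by (simp add: has_real_derivative_iff_has_vector_derivative)
    have "norm (deriv f (of_real t * z)) \<le> ?N * (1 - t * norm z) powr - \<alpha>"
      using bloch_deriv_le[OF f, of "of_real t * z"] a tz[OF t] ntz[OF t] by simp
    then have "norm z * norm (deriv f (of_real t * z)) \<le> norm z * (?N * (1 - t * norm z) powr - \<alpha>)"
      by (rule mult_left_mono) simp
    then show "norm (z * deriv f (of_real t * z)) \<le> ?N * norm z * (1 - t * norm z) powr - \<alpha>"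
      by (simp add: norm_mult mult_ac)
  qed simp
  \<comment> \<open>The term \<open>?\<phi> 0\<close> is nonnegative and is dropped.\<close>
  then have "norm (f z - f 0) \<le> ?N / (\<alpha> - 1) * (1 - norm z) powr (1 - \<alpha>)"
    using N a by (simp add: divide_simps mult_nonneg_nonneg split: if_splits) 
  \<comment> \<open>A negative power of a number in (0,1] is at least 1, so f(0) is absorbed into
    the growth factor.\<close>
  moreover have "norm (f 0) \<le> ?N * (1 - norm z) powr (1 - \<alpha>)"
  proof -
    have "1 powr (1 - \<alpha>) \<le> (1 - norm z) powr (1 - \<alpha>)"
      using a z by (intro powr_mono2') auto
    then have "?N * 1 \<le> ?N * (1 - norm z) powr (1 - \<alpha>)"
      using N by (intro mult_left_mono) auto
    then show ?thesis using norm_0_le_bloch_norm[OF f] by linarith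
  qed
  moreover have "norm (f z) \<le> norm (f z - f 0) + norm (f 0)"
    by (metis diff_add_cancel norm_triangle_ineq)
  ultimately have "norm (f z) \<le> (?N / (\<alpha> - 1) + ?N) * (1 - norm z) powr (1 - \<alpha>)"
    by (simp add: distrib_right)
  also have "?N / (\<alpha> - 1) + ?N = (\<alpha> / (\<alpha> - 1)) * ?N"
    using a by (simp add: field_simps)
  finally show ?thesis .
qed

text \<open>The quotient rule splits the derivative into f'/(1-z) and f/(1-z)^2. With |1-z| \<ge>
  1-|z|, both terms have order (1-|z|)^(-\<alpha>-1), with constants 1 from
  \<open>bloch_deriv_le\<close> and \<alpha>/(\<alpha>-1) from \<open>bloch_growth\<close>.\<close>

lemma bloch_deriv_quotient_le:
  assumes f: "f \<in> bloch \<alpha>" and a: "1 < \<alpha>" and z: "norm z < 1"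
  shows "norm (deriv (\<lambda>w. f w / (1 - w)) z)
    \<le> (1 + \<alpha> / (\<alpha> - 1)) * bloch_norm \<alpha> f * (1 - norm z) powr - (\<alpha> + 1)"
proof -
  let ?N = "bloch_norm \<alpha> f" and ?d = "1 - norm z"
  have N: "0 \<le> ?N" by (rule bloch_norm_nonneg[OF f])
  have d: "?d > 0" "?d \<le> norm (1 - z)"
    using z norm_triangle_ineq2[of 1 z] by auto
  have z1: "1 - z \<noteq> 0" using z by auto
  have fd: "f field_differentiable at z"
    using bloch_holomorphic[OF f] z by (intro holomorphic_on_imp_differentiable_at[of f "ball 0 1"]) auto
  have "deriv (\<lambda>w. f w / (1 - w)) z = (deriv f z * (1 - z) + f z) / (1 - z)\<^sup>2"
    using z1 fd by (subst deriv_divide) (auto intro!: derivative_intros)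
  also have "\<dots> = deriv f z / (1 - z) + f z / (1 - z)\<^sup>2"
    using z1 by (simp add: add_divide_distrib power2_eq_square)
  finally have "norm (deriv (\<lambda>w. f w / (1 - w)) z) \<le> norm (deriv f z) / norm (1 - z) + norm (f z) / (norm (1 - z))\<^sup>2"
    using norm_triangle_ineq[of "deriv f z / (1 - z)" "f z / (1 - z)\<^sup>2"]
    by (simp add: norm_divide norm_power)
  also have "\<dots> \<le> (?N * ?d powr - \<alpha>) / ?d + ((\<alpha> / (\<alpha> - 1)) * ?N * ?d powr (1 - \<alpha>)) / ?d\<^sup>2"
    using a z d N bloch_deriv_le[OF f _ z] bloch_growth[OF f a z]
    by (intro add_mono frac_le power_mono mult_nonneg_nonneg) auto
  \<comment> \<open>Both powers are written as multiples of the target power so that the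
    denominators cancel.\<close>
  also have "?d powr - \<alpha> = ?d powr - (\<alpha> + 1) * ?d"
    using d powr_add[of ?d "- (\<alpha> + 1)" 1] by simp
  also have "?d powr (1 - \<alpha>) = ?d powr - (\<alpha> + 1) * ?d\<^sup>2"
    using d powr_add[of ?d "- (\<alpha> + 1)" 2] by (simp add: algebra_simps)
  finally show ?thesis using d by (simp add: distrib_right)
qed

section \<open>The test function (1-w)^(1-\<alpha>)\<close>

lemma
  fixes a :: real and z :: complex
  assumes z: "norm z < 1"
  shows has_field_derivative_one_minus_powr:
      "((\<lambda>w. (1 - w) powr of_real a) has_field_derivative - of_real a * (1 - z) powr of_real (a - 1)) (at z)"
    and deriv_one_minus_powr:
      "deriv (\<lambda>w. (1 - w) powr of_real a) z = - of_real a * (1 - z) powr of_real (a - 1)"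
proof -
  \<comment> \<open>For z in the disc, 1 - z lies in the right half plane, away from the branch cut
    of the principal power.\<close>
  have "Re (1 - z) > 0" using z complex_Re_le_cmod[of z] by simp
  then have "1 - z \<notin> \<real>\<^sub>\<le>\<^sub>0" using complex_nonpos_Reals_iff by force
  then have "((\<lambda>w. w powr of_real a) has_field_derivative of_real a * (1 - z) powr (of_real a - 1)) (at (1 - z))"
    by (rule has_field_derivative_powr)
  moreover have "((\<lambda>w. 1 - w) has_field_derivative - 1) (at z)"
    by (auto intro!: derivative_eq_intros)
  ultimately show "((\<lambda>w. (1 - w) powr of_real a) has_field_derivative - of_real a * (1 - z) powr of_real (a - 1)) (at z)"
    using DERIV_chain2[of "\<lambda>w. w powr of_real a" _ "\<lambda>w. 1 - w" z] by fastforce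
  then show "deriv (\<lambda>w. (1 - w) powr of_real a) z = - of_real a * (1 - z) powr of_real (a - 1)"
    by (rule DERIV_imp_deriv)
qed

lemma one_minus_powr_in_bloch:
  assumes a: "0 < \<alpha>"
  shows "(\<lambda>w. (1 - w) powr of_real (1 - \<alpha>)) \<in> bloch \<alpha>"
proof (rule bloch_normI[where D = "\<bar>1 - \<alpha>\<bar>"])
  show "(\<lambda>w. (1 - w) powr of_real (1 - \<alpha>)) holomorphic_on ball 0 1"
  proof (rule holomorphic_onI)
    fix z :: complex assume "z \<in> ball 0 1"
    then have "norm z < 1" by simp
    from has_field_derivative_one_minus_powr[OF this]
    show "(\<lambda>w. (1 - w) powr of_real (1 - \<alpha>)) field_differentiable (at z within ball 0 1)"
      unfolding field_differentiable_def by (blast intro: has_field_derivative_at_within)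
  qed
  fix z :: complex assume z: "norm z < 1"
  have "norm (1 - z) powr - \<alpha> \<le> (1 - norm z) powr - \<alpha>"
    using z a norm_triangle_ineq2[of 1 z] by (intro powr_mono2') auto
  then show "norm (deriv (\<lambda>w. (1 - w) powr of_real (1 - \<alpha>)) z) \<le> \<bar>1 - \<alpha>\<bar> * (1 - norm z) powr - \<alpha>"
    unfolding deriv_one_minus_powr[OF z] norm_mult
    by (intro mult_mono) (auto simp: norm_powr_real_powr' simp del: of_real_diff of_real_minus)
qed (rule a)

section \<open>Finite measures on [0,1) and their moments\<close>

locale unit_interval_measure = finite_measure \<mu> for \<mu> :: "real measure" +
  assumes sets_eq: "sets \<mu> = sets (restrict_space borel {0..<1})"
begin

lemma space_eq: "space \<mu> = {0..<1}"
  using sets_eq_imp_space_eq[OF sets_eq] by (simp add: space_restrict_space)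

lemma borel_measurable_restrict: "f \<in> borel_measurable borel \<Longrightarrow> f \<in> borel_measurable \<mu>"
  unfolding measurable_cong_sets[OF sets_eq refl] by (rule measurable_restrict_space1)

lemma sets_tail: "{x..<1} \<in> sets \<mu>" if "0 \<le> x"
proof -
  have "{x..<1} = {x..<1} \<inter> {0..<1}" using that by auto
  moreover have "{x..<1} \<in> sets borel" by simp
  ultimately show ?thesis unfolding sets_eq sets_restrict_space by (metis image_eqI Int_commute)
qed

lemma power_le_one_space: "t \<in> space \<mu> \<Longrightarrow> t ^ n \<le> 1"
  by (simp add: space_eq power_le_one)

lemma integrable_power: "integrable \<mu> (\<lambda>t. t ^ n)"
  by (rule integrable_const_bound[where B = 1])
     (auto simp: space_eq power_le_one intro!: borel_measurable_restrict)

lemma moment_nonneg: "0 \<le> moment \<mu> n"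
  unfolding moment_def by (rule integral_nonneg_AE, rule AE_I2) (simp add: space_eq)

lemma moment_le: "moment \<mu> n \<le> measure \<mu> (space \<mu>)"
proof -
  have "moment \<mu> n \<le> (LINT t|\<mu>. 1)"
    unfolding moment_def by (intro integral_mono integrable_power) (auto simp: power_le_one_space)
  then show ?thesis by simp
qed

section \<open>Power series and integral formula for the derivative of C f\<close>

context
  fixes f g :: "complex \<Rightarrow> complex"
  assumes hol: "f holomorphic_on ball 0 1"
  defines "g \<equiv> \<lambda>w. f w / (1 - w)"
begin

lemma quotient_holomorphic: "g holomorphic_on ball 0 1"
  unfolding g_def by (intro holomorphic_intros hol) auto

text \<open>Division by 1-w is multiplication by the geometric series, and a Cauchy product with the
  constant sequence 1 forms partial sums. This links the coefficients in \<open>cesaro_like\<close>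
  to g.\<close>

lemma fps_nth_quotient:
  "fps_nth (fps_expansion g 0) n = (\<Sum>k\<le>n. fps_nth (fps_expansion f 0) k)"
proof -
  have inv: "inverse (1 - fps_X) = Abs_fps (\<lambda>n. 1 :: complex)"
    using fps_inverse_idempotent[of "Abs_fps (\<lambda>n. 1 :: complex)"] by (simp add: fps_inverse_gp')
  have "f has_fps_expansion fps_expansion f 0"
    by (rule has_fps_expansion_fps_expansion[OF _ _ hol]) auto
  moreover have "(\<lambda>w. inverse (1 - w)) has_fps_expansion inverse (1 - fps_X :: complex fps)"
    by (intro fps_expansion_intros) auto
  ultimately have "(\<lambda>w. f w * inverse (1 - w)) has_fps_expansion
      fps_expansion f 0 * inverse (1 - fps_X)"
    by (rule has_fps_expansion_mult)
  then have "fps_expansion g 0 = fps_expansion f 0 * Abs_fps (\<lambda>n. 1)"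
    unfolding g_def inv by (intro fps_expansion_eqI) (simp add: divide_inverse)
  then show ?thesis by (simp add: fps_mult_nth atLeast0AtMost)
qed

text \<open>As a formal power series, C f gets its holomorphy and termwise derivative from the
  theory of \<open>eval_fps\<close>.\<close>

definition cesaro_fps :: "complex fps" where
  "cesaro_fps = Abs_fps (\<lambda>n. of_real (moment \<mu> n) * fps_nth (fps_expansion g 0) n)"

lemma cesaro_like_eq_eval_fps: "cesaro_like \<mu> f = eval_fps cesaro_fps"
  by (rule ext) (simp add: cesaro_like_def eval_fps_def cesaro_fps_def fps_nth_quotient)

lemma quotient_conv_radius: "fps_conv_radius (fps_expansion g 0) \<ge> 1"
  using conv_radius_fps_expansion[of g 0 1] quotient_holomorphic by (simp add: one_ereal_def)

text \<open>The moments are bounded by the total mass, so the series is dominated by a multiple of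
  the absolutely convergent series of g.\<close>

lemma cesaro_fps_conv_radius: "fps_conv_radius cesaro_fps \<ge> 1"
  unfolding fps_conv_radius_def
proof (rule conv_radius_geI_ex')
  fix r :: real assume r: "0 < r" "ereal r < 1"
  let ?b = "\<lambda>n. norm (fps_nth (fps_expansion g 0) n * of_real r ^ n)"
  have "summable ?b"
    using r quotient_conv_radius by (intro norm_summable_fps ereal_less_of_one_le) auto
  then have "summable (\<lambda>n. measure \<mu> (space \<mu>) * ?b n)" by (rule summable_mult)
  then show "summable (\<lambda>n. fps_nth cesaro_fps n * of_real r ^ n)"
    by (rule summable_comparison_test')
       (auto simp: cesaro_fps_def norm_mult norm_power moment_nonneg mult.assoc intro!: mult_right_mono moment_le)
qed

lemma cesaro_like_holomorphic: "cesaro_like \<mu> f holomorphic_on ball 0 1"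
  unfolding cesaro_like_eq_eval_fps
  by (rule holomorphic_on_eval_fps)
     (use cesaro_fps_conv_radius in \<open>auto intro: ereal_less_of_one_le\<close>)

lemma cesaro_like_0: "cesaro_like \<mu> f 0 = of_real (moment \<mu> 0) * f 0"
proof -
  have "fps_nth (fps_expansion g 0) 0 = f 0"
    by (simp add: fps_expansion_def g_def)
  then show ?thesis
    by (simp add: cesaro_like_eq_eval_fps eval_fps_at_0 cesaro_fps_def)
qed

lemma deriv_quotient_eq_eval_fps:
  assumes "norm w < 1"
  shows "deriv g w = eval_fps (fps_deriv (fps_expansion g 0)) w"
proof -
  have "eventually (\<lambda>w. w \<in> ball 0 1) (nhds w)"
    using assms by (intro eventually_nhds_in_open) auto
  then have "eventually (\<lambda>w. g w = eval_fps (fps_expansion g 0) w) (nhds w)"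
    by eventually_elim (use eval_fps_expansion'[of g 0 1] quotient_holomorphic in \<open>simp add: one_ereal_def\<close>)
  then have "deriv g w = deriv (eval_fps (fps_expansion g 0)) w"
    by (rule deriv_cong_ev) simp
  also have "\<dots> = eval_fps (fps_deriv (fps_expansion g 0)) w"
    using assms quotient_conv_radius
    by (intro eval_fps_deriv[symmetric] ereal_less_of_one_le) auto
  finally show ?thesis .
qed

text \<open>Differentiating the series of C f termwise leaves the moment of order n+1 at z^n.
  Writing it as an integral of t^(n+1) and exchanging sum and integral gives the formula. The
  exchange is justified by absolute convergence of the series of g' at z, as t \<le> 1 and the
  measure is finite.\<close>

lemma
  assumes z: "norm z < 1"
  shows integrable_deriv_quotient: "integrable \<mu> (\<lambda>t. of_real t * deriv g (of_real t * z))" (is ?I)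
    and deriv_cesaro_like:
      "deriv (cesaro_like \<mu> f) z = (LINT t|\<mu>. of_real t * deriv g (of_real t * z))" (is ?E)
proof -
  let ?B = "fps_deriv (fps_expansion g 0)"
  \<comment> \<open>Of the n+1 factors t, one is the outer factor from the chain rule and n belong
    to the argument tz of g'.\<close>
  let ?u = "\<lambda>n t. of_real (t ^ Suc n) * (fps_nth ?B n * z ^ n)"
  have rad: "norm z < fps_conv_radius ?B"
    using z fps_conv_radius_deriv[of "fps_expansion g 0"] quotient_conv_radius
    by (meson ereal_less(3) less_le_trans order.trans)
  have sm: "summable (\<lambda>n. norm (fps_nth ?B n * z ^ n))"
    by (rule norm_summable_fps[OF rad])
  have int: "integrable \<mu> (?u n)" for n
    by (intro integrable_mult_left integrable_of_real integrable_power)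
  have nrm: "norm (?u n t) \<le> norm (fps_nth ?B n * z ^ n)" if "t \<in> space \<mu>" for n t
    using that power_le_one_space[OF that, of "Suc n"] unfolding norm_mult
    by (intro mult_left_le_one_le) (auto simp: space_eq norm_mult norm_power abs_mult)
  have s1: "AE t in \<mu>. summable (\<lambda>n. norm (?u n t))"
    by (rule AE_I2, rule summable_comparison_test'[OF sm]) (use nrm in auto)
  have s2: "summable (\<lambda>n. LINT t|\<mu>. norm (?u n t))"
  proof (rule summable_comparison_test')
    show "summable (\<lambda>n. norm (fps_nth ?B n * z ^ n) * measure \<mu> (space \<mu>))"
      by (rule summable_mult2[OF sm])
    fix n
    have "(LINT t|\<mu>. norm (?u n t)) \<le> (LINT t|\<mu>. norm (fps_nth ?B n * z ^ n))"
      by (rule integral_mono[OF integrable_norm[OF int] _ nrm]) auto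
    then show "norm (LINT t|\<mu>. norm (?u n t)) \<le> norm (fps_nth ?B n * z ^ n) * measure \<mu> (space \<mu>)"
      by (simp add: mult.commute)
  qed
  have su: "of_real t * deriv g (of_real t * z) = (\<Sum>n. ?u n t)" if "t \<in> space \<mu>" for t
  proof -
    have t: "0 \<le> t" "t < 1" using that by (auto simp: space_eq)
    have tz: "norm (of_real t * z) \<le> norm z"
      using t by (simp add: norm_mult mult_left_le_one_le)
    then have "(\<lambda>n. of_real t * (fps_nth ?B n * (of_real t * z) ^ n)) sums
      (of_real t * eval_fps ?B (of_real t * z))"
      using rad by (intro sums_mult sums_eval_fps) (meson ereal_less_eq(3) le_less_trans)
    moreover have "deriv g (of_real t * z) = eval_fps ?B (of_real t * z)"
      using tz z by (intro deriv_quotient_eq_eval_fps) simp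
    ultimately show ?thesis
      by (simp add: sums_iff power_mult_distrib mult_ac)
  qed
  show ?I
    using integrable_suminf[OF int s1 s2] by (subst Bochner_Integration.integrable_cong[OF refl su]) auto
  have "(LINT t|\<mu>. of_real t * deriv g (of_real t * z)) = (\<Sum>n. integral\<^sup>L \<mu> (?u n))"
    using integral_suminf[OF int s1 s2] by (subst Bochner_Integration.integral_cong[OF refl su]) auto
  also have "\<dots> = (\<Sum>n. of_real (moment \<mu> (Suc n)) * (fps_nth ?B n * z ^ n))"
    by (simp add: integral_of_real moment_def del: of_real_power of_real_mult power_Suc fps_deriv_nth)
  also have "\<dots> = eval_fps (fps_deriv cesaro_fps) z"
    by (simp add: eval_fps_def cesaro_fps_def mult_ac)
  also have "\<dots> = deriv (cesaro_like \<mu> f) z"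
    unfolding cesaro_like_eq_eval_fps using z cesaro_fps_conv_radius
    by (intro eval_fps_deriv ereal_less_of_one_le) auto
  finally show ?E by simp
qed

end

section \<open>Sufficiency: from tail bounds to boundedness\<close>

text \<open>Dyadic decomposition of $[0,1)$ according to the size of \<open>1 - t\<close> relative to \<open>1 - r\<close>.\<close>

lemma nn_integral_kernel_le:
  assumes M: "0 \<le> M" and tail: "\<And>x. 0 \<le> x \<Longrightarrow> x < 1 \<Longrightarrow> measure \<mu> {x..<1} \<le> M * (1 - x) powr s"
    and s: "0 < s" "s < p" and r: "0 \<le> r" "r < 1"
  shows "(\<integral>\<^sup>+ t. ennreal ((1 - t * r) powr - p) \<partial>\<mu>)
    \<le> ennreal (2 powr p * M / (1 - 2 powr (s - p)) * (1 - r) powr (s - p))"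
proof -
  define d where "d k = 2 ^ k * (1 - r)" for k :: nat
  have d_pos: "d k > 0" for k using r by (simp add: d_def)
  \<comment> \<open>These are nested tails, namely the points with 1-t \<le> \<open>d k\<close>,
    rather than disjoint shells. An upper bound suffices, and the tail hypothesis applies to them
    directly.\<close>
  define A where "A k = {max 0 (1 - d k)..<1}" for k
  have A: "A k \<in> sets \<mu>" for k unfolding A_def by (rule sets_tail) simp
  let ?u = "\<lambda>k t. ennreal (2 powr p * d k powr - p) * indicator (A k) t"
  let ?q = "2 powr (s - p)"
  have q: "0 < ?q" "?q < 1" using s by (auto simp: powr_less_one)
  have pointwise: "ennreal ((1 - t * r) powr - p) \<le> (\<Sum>k. ?u k t)" if "t \<in> space \<mu>" for t
  proof -
    have t: "0 \<le> t" "t < 1" using that by (auto simp: space_eq)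
    obtain k0 :: nat where "(1 - t) / (1 - r) < 2 ^ k0"
      using real_arch_pow[of 2 "(1 - t) / (1 - r)"] by auto
    then have k0: "1 - t \<le> d k0" using r by (simp add: d_def field_simps)
    \<comment> \<open>The least such scale satisfies \<open>d k / 2\<close> \<le> 1 - tr: for k = 0
      because 1 - tr \<ge> 1 - r, and otherwise because minimality gives 1 - t >
      \<open>d (k - 1)\<close>, which is half of \<open>d k\<close>. The k-th term alone then
      dominates the kernel at t.\<close>
    define k where "k = (LEAST k. 1 - t \<le> d k)"
    have k: "1 - t \<le> d k" unfolding k_def by (rule LeastI[of _ k0]) (rule k0)
    have half: "d k / 2 \<le> 1 - t * r"
    proof (cases k)
      case 0
      have "t * r \<le> r" using t r by (intro mult_left_le_one_le) auto
      then show ?thesis using 0 r by (simp add: d_def)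
    next
      case (Suc j)
      then have "\<not> 1 - t \<le> d j" using not_less_Least[of j "\<lambda>k. 1 - t \<le> d k"] k_def by simp
      moreover have "t * r \<le> t" using t r by (intro mult_right_le_one_le) auto
      ultimately show ?thesis using Suc by (simp add: d_def)
    qed
    have "(1 - t * r) powr - p \<le> (d k / 2) powr - p"
      using half d_pos[of k] s by (intro powr_mono2') auto
    also have "\<dots> = 2 powr p * d k powr - p"
      using d_pos[of k] by (simp add: powr_divide powr_minus field_simps)
    finally have "ennreal ((1 - t * r) powr - p) \<le> ?u k t"
      using k t by (simp add: A_def indicator_def ennreal_leI)
    also have "\<dots> = (\<Sum>k\<in>{k}. ?u k t)"
      by (simp only: sum.insert sum.empty finite.emptyI empty_iff not_False_eq_True add_0_right)
    also have "\<dots> \<le> (\<Sum>k. ?u k t)"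
      by (rule sum_le_suminf) auto
    finally show ?thesis .
  qed
  \<comment> \<open>The tail bound contributes (d k)^s and the kernel (d k)^(-p). As s < p, the
    pieces decay geometrically with ratio \<open>?q\<close>.\<close>
  have piece: "(\<integral>\<^sup>+ t. ?u k t \<partial>\<mu>) \<le> ennreal (2 powr p * M * (1 - r) powr (s - p) * ?q ^ k)" for k
  proof -
    have "measure \<mu> (A k) \<le> M * (1 - max 0 (1 - d k)) powr s"
      unfolding A_def using d_pos[of k] by (intro tail) auto
    \<comment> \<open>When \<open>d k\<close> exceeds 1, the left side has 1 in place of
      \<open>d k\<close>, hence an inequality.\<close>
    also have "\<dots> \<le> M * d k powr s"
      using d_pos[of k] s M by (intro mult_left_mono powr_mono2) auto
    finally have m: "measure \<mu> (A k) \<le> M * d k powr s" .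
    have "d k powr - p * d k powr s = d k powr (s - p)"
      by (simp flip: powr_add)
    also have "\<dots> = ?q ^ k * (1 - r) powr (s - p)"
      using r by (simp add: d_def powr_mult powr_power powr_powr mult.commute flip: powr_realpow)
    finally have d_powr: "d k powr - p * d k powr s = ?q ^ k * (1 - r) powr (s - p)" .
    have "(\<integral>\<^sup>+ t. ?u k t \<partial>\<mu>) = ennreal (2 powr p * d k powr - p) * emeasure \<mu> (A k)"
      by (rule nn_integral_cmult_indicator[OF A])
    also have "\<dots> = ennreal (2 powr p * d k powr - p * measure \<mu> (A k))"
      by (simp add: emeasure_eq_measure ennreal_mult)
    also have "\<dots> \<le> ennreal (2 powr p * d k powr - p * (M * d k powr s))"
      using m by (intro ennreal_leI mult_left_mono) auto
    also have "2 powr p * d k powr - p * (M * d k powr s) = 2 powr p * M * (d k powr - p * d k powr s)"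
      by (simp only: mult_ac)
    also have "\<dots> = 2 powr p * M * (1 - r) powr (s - p) * ?q ^ k"
      unfolding d_powr by (simp only: mult_ac)
    finally show ?thesis .
  qed
  have "(\<integral>\<^sup>+ t. ennreal ((1 - t * r) powr - p) \<partial>\<mu>) \<le> (\<integral>\<^sup>+ t. (\<Sum>k. ?u k t) \<partial>\<mu>)"
    by (rule nn_integral_mono) (rule pointwise)
  also have "\<dots> = (\<Sum>k. \<integral>\<^sup>+ t. ?u k t \<partial>\<mu>)"
    using A by (intro nn_integral_suminf) auto
  also have "\<dots> \<le> (\<Sum>k. ennreal (2 powr p * M * (1 - r) powr (s - p) * ?q ^ k))"
    by (intro suminf_le piece summableI)
  also have "\<dots> = ennreal (2 powr p * M * (1 - r) powr (s - p) * (1 / (1 - ?q)))"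
    using q M by (intro suminf_ennreal_eq sums_mult geometric_sums) auto
  finally show ?thesis by (simp add: mult_ac)
qed

lemma bounded_cesaro_like_if_tail_bound:
  assumes a: "1 < \<alpha>" and b: "0 < \<beta>" "\<beta> < \<alpha> + 1" and M: "0 \<le> M"
    and tail: "\<And>x. 0 \<le> x \<Longrightarrow> x < 1 \<Longrightarrow> measure \<mu> {x..<1} \<le> M * (1 - x) powr (\<alpha> + 1 - \<beta>)"
  shows "bounded_bloch_operator \<alpha> \<beta> (cesaro_like \<mu>)"
proof -
  \<comment> \<open>\<open>K\<close> is the constant of \<open>nn_integral_kernel_le\<close> for s =
    \<alpha>+1-\<beta> and p = \<alpha>+1, where s - p = -\<beta>; \<open>L\<close> is that of
    \<open>bloch_deriv_quotient_le\<close>.\<close>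
  define K where "K = 2 powr (\<alpha> + 1) * M / (1 - 2 powr - \<beta>)"
  define L where "L = 1 + \<alpha> / (\<alpha> - 1)"
  have "2 powr - \<beta> < (1::real)" using b by (simp add: powr_less_one)
  then have K: "0 \<le> K" unfolding K_def using M by simp
  have L: "0 \<le> L" unfolding L_def using a by simp
  have deriv_le: "norm (deriv (cesaro_like \<mu> f) z) \<le> (L * bloch_norm \<alpha> f * K) * (1 - norm z) powr - \<beta>"
    if f: "f \<in> bloch \<alpha>" and z: "norm z < 1" for f z
  proof -
    let ?g = "\<lambda>w. f w / (1 - w)" and ?N = "bloch_norm \<alpha> f"
    have N: "0 \<le> ?N" by (rule bloch_norm_nonneg[OF f])
    have hol: "f holomorphic_on ball 0 1" by (rule bloch_holomorphic[OF f])
    have pw: "norm (of_real t * deriv ?g (of_real t * z)) \<le> L * ?N * (1 - t * norm z) powr - (\<alpha> + 1)"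
      if "t \<in> space \<mu>" for t
    proof -
      have t: "0 \<le> t" "t < 1" using that by (auto simp: space_eq)
      have ntz: "norm (of_real t * z) = t * norm z" using t by (simp add: norm_mult)
      have "t * norm z \<le> norm z" using t by (intro mult_left_le_one_le) auto
      then have "norm (deriv ?g (of_real t * z)) \<le> L * ?N * (1 - t * norm z) powr - (\<alpha> + 1)"
        using bloch_deriv_quotient_le[OF f a, of "of_real t * z"] z unfolding ntz L_def by linarith
      moreover have "norm (of_real t * deriv ?g (of_real t * z)) \<le> norm (deriv ?g (of_real t * z))"
        using t unfolding norm_mult by (intro mult_left_le_one_le) auto
      ultimately show ?thesis by linarith
    qed
    \<comment> \<open>Extended nonnegative integrals let the kernel estimate provide finiteness
      along with the bound.\<close>
    have "ennreal (norm (deriv (cesaro_like \<mu> f) z)) \<le>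
        (\<integral>\<^sup>+ t. norm (of_real t * deriv ?g (of_real t * z)) \<partial>\<mu>)"
      unfolding deriv_cesaro_like[OF hol z]
      by (rule integral_norm_bound_ennreal[OF integrable_deriv_quotient[OF hol z]])
    also have "\<dots> \<le> (\<integral>\<^sup>+ t. ennreal (L * ?N) * ennreal ((1 - t * norm z) powr - (\<alpha> + 1)) \<partial>\<mu>)"
      using L N by (intro nn_integral_mono) (auto simp flip: ennreal_mult intro!: ennreal_leI dest: pw)
    also have "\<dots> = ennreal (L * ?N) * (\<integral>\<^sup>+ t. ennreal ((1 - t * norm z) powr - (\<alpha> + 1)) \<partial>\<mu>)"
      by (intro nn_integral_cmult borel_measurable_restrict) auto
    also have "\<dots> \<le> ennreal (L * ?N) * ennreal (K * (1 - norm z) powr - \<beta>)"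
      using nn_integral_kernel_le[OF M tail, of "\<alpha> + 1" "norm z"] b z
      unfolding K_def by (intro mult_left_mono) auto
    also have "\<dots> = ennreal (L * ?N * K * (1 - norm z) powr - \<beta>)"
      using L N K by (simp add: mult.assoc flip: ennreal_mult)
    finally show ?thesis using L N K by (simp add: ennreal_le_iff)
  qed
  \<comment> \<open>The total mass controls the value at 0, which is the zeroth moment times f(0);
    the second summand is the derivative bound passed through \<open>bloch_normI\<close>.\<close>
  let ?C = "measure \<mu> (space \<mu>) + 2 powr \<beta> * (L * K)"
  have "cesaro_like \<mu> f \<in> bloch \<beta> \<and> bloch_norm \<beta> (cesaro_like \<mu> f) \<le> ?C * bloch_norm \<alpha> f"
    if f: "f \<in> bloch \<alpha>" for f
  proof -
    note hol = bloch_holomorphic[OF f]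
    note I = bloch_normI[OF cesaro_like_holomorphic[OF hol] b(1) deriv_le[OF f]]
    have "norm (cesaro_like \<mu> f 0) \<le> measure \<mu> (space \<mu>) * bloch_norm \<alpha> f"
      unfolding cesaro_like_0[OF hol] norm_mult using f
      by (intro mult_mono) (auto simp: moment_nonneg moment_le norm_0_le_bloch_norm)
    with I show ?thesis by (auto simp: algebra_simps)
  qed
  then show ?thesis unfolding bounded_bloch_operator_def by blast
qed

section \<open>Necessity: from the test function to tail bounds\<close>

text \<open>For x \<ge> 1/2, the derivative of the image of the test function at x is at most N
  (1-x)^(-\<beta>) and at least a multiple of (1-x)^(-\<alpha>-1) times the tail mass; comparing the
  two yields the exponent \<alpha>+1-\<beta>. For smaller x the total mass is enough.\<close>

lemma tail_bound_if_bounded_cesaro_like: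
  assumes a: "0 < \<alpha>" and b: "0 \<le> \<beta>" "\<beta> < \<alpha> + 1"
    and maps: "\<And>f. f \<in> bloch \<alpha> \<Longrightarrow> cesaro_like \<mu> f \<in> bloch \<beta>"
  obtains M where "0 \<le> M"
    "\<And>x. 0 \<le> x \<Longrightarrow> x < 1 \<Longrightarrow> measure \<mu> {x..<1} \<le> M * (1 - x) powr (\<alpha> + 1 - \<beta>)"
proof -
  let ?s = "\<alpha> + 1 - \<beta>" and ?p = "\<alpha> + 1"
  let ?f = "\<lambda>w::complex. (1 - w) powr of_real (1 - \<alpha>)"
  have f: "?f \<in> bloch \<alpha>" by (rule one_minus_powr_in_bloch[OF a])
  note hol = bloch_holomorphic[OF f]
  let ?g = "\<lambda>w. ?f w / (1 - w)"
  define N where "N = bloch_norm \<beta> (cesaro_like \<mu> ?f)"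
  have N: "0 \<le> N" unfolding N_def by (rule bloch_norm_nonneg[OF maps[OF f]])
  have g: "deriv ?g w = of_real \<alpha> * (1 - w) powr of_real (- ?p)" if "norm w < 1" for w
  proof -
    have "eventually (\<lambda>w. w \<in> ball 0 1) (nhds w)"
      using that by (intro eventually_nhds_in_open) auto
    then have "eventually (\<lambda>w. ?g w = (1 - w) powr of_real (- \<alpha>)) (nhds w)"
    proof eventually_elim
      case (elim w)
      then have "1 - w \<noteq> 0" by auto
      then show ?case using powr_diff[of "1 - w" "of_real (1 - \<alpha>)" 1] by (simp add: powr_to_1)
    qed
    then have "deriv ?g w = deriv (\<lambda>w. (1 - w) powr of_real (- \<alpha>)) w"
      by (rule deriv_cong_ev) simp
    moreover have "- ?p = - \<alpha> - 1" by simp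
    ultimately show ?thesis unfolding deriv_one_minus_powr[OF that] by simp
  qed
  have near: "measure \<mu> {x..<1} \<le> N * 2 powr (?p + 1) / \<alpha> * (1 - x) powr ?s"
    if x: "1/2 \<le> x" "x < 1" for x
  proof -
    let ?h = "\<lambda>t. \<alpha> * t * (1 - t * x) powr - ?p"
    \<comment> \<open>A lower bound for \<open>?h\<close> on [x,1): there t \<ge> x \<ge> 1/2 and 1
      - tx \<le> 2(1-x).\<close>
    define c where "c = \<alpha> / 2 * (2 * (1 - x)) powr - ?p"
    have c: "c > 0" using a x by (simp add: c_def)
    \<comment> \<open>At a real point the integrand is real and nonnegative, so no cancellation
      weakens the lower bound.\<close>
    have eq: "of_real t * deriv ?g (of_real t * of_real x) = complex_of_real (?h t)" if "t \<in> space \<mu>" for t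
    proof -
      have t: "0 \<le> t" "t < 1" using that by (auto simp: space_eq)
      then have "t * x \<le> x" using x by (intro mult_left_le_one_le) auto
      then have tx: "t * x < 1" using x by linarith
      have "norm (complex_of_real t * of_real x) < 1" using t x tx by (simp add: norm_mult)
      from g[OF this] have "deriv ?g (of_real t * of_real x) = of_real \<alpha> * (of_real (1 - t * x)) powr of_real (- ?p)"
        by simp
      also have "\<dots> = of_real (\<alpha> * (1 - t * x) powr - ?p)"
        using tx by (subst powr_of_real) auto
      finally show ?thesis by simp
    qed
    have nx: "norm (complex_of_real x) < 1" using x by simp
    have int: "integrable \<mu> ?h"
      using integrable_deriv_quotient[OF hol nx]
      by (subst (asm) Bochner_Integration.integrable_cong[OF refl eq]) (auto simp only: complex_of_real_integrable_eq)
    have "c * measure \<mu> {x..<1} = (LINT t|\<mu>. c * indicator {x..<1} t)"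
      using sets_tail[of x] x by (simp add: emeasure_eq_measure)
    also have "\<dots> \<le> integral\<^sup>L \<mu> ?h"
    proof (rule integral_mono[OF _ int])
      show "integrable \<mu> (\<lambda>t. c * indicator {x..<1} t)"
        using sets_tail[of x] x by (intro integrable_mult_right integrable_real_indicator) (auto simp: emeasure_eq_measure)
      fix t assume "t \<in> space \<mu>"
      then have t: "0 \<le> t" "t < 1" by (auto simp: space_eq)
      show "c * indicator {x..<1} t \<le> ?h t"
      proof (cases "x \<le> t")
        case True
        have "x * x \<le> t * x" using True x by (intro mult_right_mono) auto
        \<comment> \<open>This square being nonnegative says 1 - x^2 \<le> 2(1-x).\<close>
        moreover have "0 \<le> (1 - x) * (1 - x)" by simp
        ultimately have "1 - t * x \<le> 2 * (1 - x)" by (simp add: algebra_simps)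
        moreover have "t * x \<le> x" using t x by (intro mult_left_le_one_le) auto
        ultimately have "(2 * (1 - x)) powr - ?p \<le> (1 - t * x) powr - ?p"
          using a x by (intro powr_mono2') linarith+
        then have "c \<le> ?h t" unfolding c_def
          using True x a by (intro mult_mono) auto
        then show ?thesis using True t by simp
      qed (use a t in auto)
    qed
    also have "\<dots> \<le> norm (deriv (cesaro_like \<mu> ?f) (of_real x))"
    proof -
      have "deriv (cesaro_like \<mu> ?f) (of_real x) = of_real (integral\<^sup>L \<mu> ?h)"
        unfolding deriv_cesaro_like[OF hol nx]
        by (subst Bochner_Integration.integral_cong[OF refl eq]) (simp_all only: integral_complex_of_real)
      then show ?thesis by (simp del: of_real_mult)
    qed
    also have "\<dots> \<le> N * (1 - x) powr - \<beta>"
      using bloch_deriv_le[OF maps[OF f] b(1) nx] x unfolding N_def by simp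
    finally have "measure \<mu> {x..<1} \<le> N * (1 - x) powr - \<beta> / c"
      using c by (simp add: field_simps)
    also have "\<dots> = N * 2 powr (?p + 1) / \<alpha> * ((1 - x) powr ?p * (1 - x) powr - \<beta>)"
    proof -
      \<comment> \<open>The powers are abstracted to P = 2^p, Q = (1-x)^p and B = (1-x)^(-\<beta>),
        leaving pure field algebra.\<close>
      have *: "N * B / (\<alpha> / 2 * inverse (P * Q)) = N * (P * 2) / \<alpha> * (Q * B)"
        if "P > 0" "Q > 0" for B P Q :: real
        using that a by (simp add: field_simps)
      have c_eq: "c = \<alpha> / 2 * inverse (2 powr ?p * (1 - x) powr ?p)"
        by (simp only: c_def powr_minus powr_mult)
      have p_eq: "2 powr (?p + 1) = 2 powr ?p * (2::real)"
        by (simp only: powr_add) simp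
      show ?thesis unfolding c_eq p_eq by (rule *) (use x in auto)
    qed
    also have "(1 - x) powr ?p * (1 - x) powr - \<beta> = (1 - x) powr ?s"
      by (simp flip: powr_add)
    finally show ?thesis .
  qed
  define m where "m = measure \<mu> (space \<mu>)"
  \<comment> \<open>Here 2(1-x) > 1, so the total mass times its positive power already
    dominates.\<close>
  have far: "measure \<mu> {x..<1} \<le> m * 2 powr ?s * (1 - x) powr ?s" if x: "0 \<le> x" "x < 1/2" for x
  proof -
    have "measure \<mu> {x..<1} \<le> m" unfolding m_def by (rule bounded_measure)
    also have "\<dots> = m * 1 powr ?s" by simp
    also have "\<dots> \<le> m * (2 * (1 - x)) powr ?s"
      using x b by (intro mult_left_mono powr_mono2) (auto simp: m_def)
    finally show ?thesis by (simp only: powr_mult mult.assoc)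
  qed
  show ?thesis
  proof (rule that[of "N * 2 powr (?p + 1) / \<alpha> + m * 2 powr ?s"])
    show "0 \<le> N * 2 powr (?p + 1) / \<alpha> + m * 2 powr ?s" using N a by (simp add: m_def)
    fix x :: real assume x: "0 \<le> x" "x < 1"
    have "0 \<le> N * 2 powr (?p + 1) / \<alpha> * (1 - x) powr ?s" "0 \<le> m * 2 powr ?s * (1 - x) powr ?s"
      using N a by (auto simp: m_def)
    then show "measure \<mu> {x..<1} \<le> (N * 2 powr (?p + 1) / \<alpha> + m * 2 powr ?s) * (1 - x) powr ?s"
      using near[of x] far[of x] x by (cases "1/2 \<le> x") (auto simp: distrib_right)
  qed
qed

section \<open>Carleson boxes and tails\<close>

text \<open>With x = 1 - l/(2 pi), every box of arc length l meets [0,1) inside [x,1), and the box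
  over an arc centred at 1 contains [x,1). Since l = 2 pi (1-x), the constants differ only by powers
  of 2 pi.\<close>

lemma carleson_disc_measure_iff:
  "carleson_measure s (disc_measure \<mu>) \<longleftrightarrow>
    (\<exists>M\<ge>0. \<forall>x. 0 \<le> x \<longrightarrow> x < 1 \<longrightarrow> measure \<mu> {x..<1} \<le> M * (1 - x) powr s)"
    (is "?L \<longleftrightarrow> ?R")
proof
  let ?\<nu> = "disc_measure \<mu>"
  let ?S = "SUP (I, l) \<in> {(I, l). circle_arc I l}. emeasure ?\<nu> (carleson_box I l) / ennreal (l powr s)"
  have sets_disc: "sets ?\<nu> = sets (restrict_space borel (ball 0 1))"
    by (simp add: disc_measure_def)
  {
    assume ?L
    then have "?S < \<infinity>" by (simp add: carleson_measure_def)
    then obtain c where c: "0 \<le> c" "?S = ennreal c" by (cases ?S) auto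
    show ?R
    proof (intro exI[of _ "c * (2 * pi) powr s"] conjI allI impI)
      show "0 \<le> c * (2 * pi) powr s" using c by simp
      fix x :: real assume x: "0 \<le> x" "x < 1"
      define l where "l = 2 * pi * (1 - x)"
      define J where "J = {- l / 2..l / 2}"
      have l: "0 < l" "l \<le> 2 * pi" "1 - l / (2 * pi) = x" using x by (auto simp: l_def field_simps)
      have arc: "circle_arc (cis ` J) l"
        unfolding circle_arc_def using l
        by (intro conjI exI[of _ "- l / 2"] exI[of _ J]) (auto simp: J_def)
      let ?E = "carleson_box (cis ` J) l"
      \<comment> \<open>A compact polar rectangle, including radius 1, whose trace on the open disc
        is the box; this gives measurability of the box.\<close>
      define K where "K = (\<lambda>(r, \<theta>). complex_of_real r * cis \<theta>) ` ({x..1} \<times> J)"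
      have "compact K" unfolding K_def
        by (intro compact_continuous_image compact_Times continuous_intros)
           (auto simp: J_def split_beta intro!: continuous_intros)
      then have K_borel: "K \<in> sets borel" by (rule borel_compact)
      have E_eq: "?E = ball 0 1 \<inter> K"
      proof (intro equalityI subsetI)
        fix u assume "u \<in> ?E"
        then obtain r \<theta> where u: "u = of_real r * cis \<theta>" "\<theta> \<in> J" "x \<le> r" "r < 1"
          using l(3) unfolding carleson_box_def by auto
        then have "u \<in> K" unfolding K_def by (intro image_eqI[of _ _ "(r, \<theta>)"]) auto
        then show "u \<in> ball 0 1 \<inter> K" using u x by (simp add: norm_mult)
      next
        fix u assume u: "u \<in> ball 0 1 \<inter> K"
        then obtain r \<theta> where *: "u = of_real r * cis \<theta>" "\<theta> \<in> J" "x \<le> r"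
          by (auto simp: K_def)
        then have "r < 1" using u x by (simp add: norm_mult)
        then show "u \<in> ?E" using * l(3) unfolding carleson_box_def by blast
      qed
      have E: "?E \<in> sets (restrict_space borel (ball 0 1))"
        unfolding E_eq sets_restrict_space using K_borel by blast
      have sub: "{x..<1} \<subseteq> {t \<in> {0..<1}. complex_of_real t \<in> ?E}"
      proof
        fix t assume t: "t \<in> {x..<1}"
        have "1 \<in> cis ` J" using l by (force simp: J_def intro: image_eqI[of _ _ 0])
        moreover have "complex_of_real t = of_real t * 1" "1 - l / (2 * pi) \<le> t" "t < 1"
          using t l(3) by auto
        ultimately have "complex_of_real t \<in> ?E" unfolding carleson_box_def by blast
        then show "t \<in> {t \<in> {0..<1}. complex_of_real t \<in> ?E}" using t x by simp
      qed
      have meas: "{t \<in> {0..<1}. complex_of_real t \<in> ?E} \<in> sets \<mu>"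
      proof -
        have "complex_of_real -` K \<inter> space borel \<in> sets borel"
          by (rule measurable_sets[OF borel_measurable_of_real K_borel])
        moreover have "{t \<in> {0..<1}. complex_of_real t \<in> ?E} = {0..<1} \<inter> (complex_of_real -` K \<inter> space borel)"
          unfolding E_eq by auto
        ultimately show ?thesis unfolding sets_eq sets_restrict_space by blast
      qed
      have "ennreal (measure \<mu> {x..<1}) \<le> emeasure \<mu> {t \<in> {0..<1}. complex_of_real t \<in> ?E}"
        using sub meas by (simp flip: emeasure_eq_measure add: emeasure_mono)
      also have "\<dots> = emeasure ?\<nu> ?E" by (rule emeasure_disc_measure[OF sets_eq E, symmetric])
      finally have "ennreal (measure \<mu> {x..<1}) / ennreal (l powr s) \<le> emeasure ?\<nu> ?E / ennreal (l powr s)"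
        by (rule divide_right_mono_ennreal)
      also have "\<dots> \<le> ?S" using arc by (intro SUP_upper2[of "(cis ` J, l)"]) auto
      finally have "ennreal (measure \<mu> {x..<1} / l powr s) \<le> ennreal c"
        using l c by (simp add: divide_ennreal)
      then have "measure \<mu> {x..<1} / l powr s \<le> c" using c by (simp add: ennreal_le_iff)
      then have "measure \<mu> {x..<1} \<le> c * l powr s" using l by (simp add: divide_le_eq)
      then show "measure \<mu> {x..<1} \<le> c * (2 * pi) powr s * (1 - x) powr s"
        by (simp only: l_def powr_mult mult.assoc)
    qed
  next
    assume ?R
    then obtain M where M: "0 \<le> M" "\<And>x. 0 \<le> x \<Longrightarrow> x < 1 \<Longrightarrow> measure \<mu> {x..<1} \<le> M * (1 - x) powr s"
      by blast
    have "emeasure ?\<nu> (carleson_box I l) / ennreal (l powr s) \<le> ennreal (M * (1 / (2 * pi)) powr s)"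
      if "circle_arc I l" for I l
    proof -
      have l: "0 < l" "l \<le> 2 * pi" using that by (auto simp: circle_arc_def)
      define x where "x = 1 - l / (2 * pi)"
      have x: "0 \<le> x" "x < 1" using l by (auto simp: x_def)
      have lx: "l / (2 * pi) = 1 - x" by (simp add: x_def)
      have I: "norm w = 1" if "w \<in> I" for w using that \<open>circle_arc I l\<close> by (auto simp: circle_arc_def)
      have "emeasure ?\<nu> (carleson_box I l) \<le> ennreal (M * (1 - x) powr s)"
      \<comment> \<open>A set outside the sigma-algebra has \<open>emeasure\<close> 0 by convention,
        so only measurable boxes need an argument.\<close>
      proof (cases "carleson_box I l \<in> sets (restrict_space borel (ball 0 1))")
        case True
        have "{t \<in> {0..<1}. complex_of_real t \<in> carleson_box I l} \<subseteq> {x..<1}"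
        proof safe
          fix t :: real assume t: "t \<in> {0..<1}" "complex_of_real t \<in> carleson_box I l"
          then obtain r w where rw: "complex_of_real t = of_real r * w" "w \<in> I" "x \<le> r" "r < 1"
            by (auto simp: carleson_box_def x_def)
          \<comment> \<open>As w is unimodular and t, r are both nonnegative, t equals r, which is
            at least x.\<close>
          then have "\<bar>t\<bar> = \<bar>r\<bar>" using I[of w] by (metis mult.right_neutral norm_mult norm_of_real)
          then show "t \<in> {x..<1}" using t rw x by auto
        qed
        then have "emeasure ?\<nu> (carleson_box I l) \<le> emeasure \<mu> {x..<1}"
          unfolding emeasure_disc_measure[OF sets_eq True] using sets_tail[OF x(1)] by (rule emeasure_mono)
        also have "\<dots> \<le> ennreal (M * (1 - x) powr s)"
          using M(2)[OF x] by (simp add: emeasure_eq_measure ennreal_leI)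
        finally show ?thesis .
      qed (simp add: emeasure_notin_sets sets_disc)
      then have "emeasure ?\<nu> (carleson_box I l) / ennreal (l powr s)
          \<le> ennreal (M * (1 - x) powr s) / ennreal (l powr s)"
        by (rule divide_right_mono_ennreal)
      also have "\<dots> = ennreal (M * (1 / (2 * pi)) powr s)"
        using l M(1) unfolding lx[symmetric] by (simp add: divide_ennreal powr_divide)
      finally show ?thesis .
    qed
    then have "?S \<le> ennreal (M * (1 / (2 * pi)) powr s)"
      by (auto intro!: SUP_least)
    then have "?S < \<infinity>" by (rule le_less_trans) simp
    then show ?L using sets_disc by (simp add: carleson_measure_def)
  }
qed

end

theorem theorem3p2:
  fixes \<mu> :: "real measure" and \<alpha> \<beta> :: real
  assumes "finite_measure \<mu>"
    and "sets \<mu> = sets (restrict_space borel {0..<1})"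
    and "\<alpha> > 1"
    and "0 < \<beta>" and "\<beta> < \<alpha> + 1"
  shows "bounded_bloch_operator \<alpha> \<beta> (cesaro_like \<mu>)
     \<longleftrightarrow> carleson_measure (\<alpha> + 1 - \<beta>) (disc_measure \<mu>)"
proof -
  interpret unit_interval_measure \<mu>
    using assms(1,2) by (simp add: unit_interval_measure_def unit_interval_measure_axioms_def)
  show ?thesis unfolding carleson_disc_measure_iff
  proof
    assume "bounded_bloch_operator \<alpha> \<beta> (cesaro_like \<mu>)"
    then have "\<And>f. f \<in> bloch \<alpha> \<Longrightarrow> cesaro_like \<mu> f \<in> bloch \<beta>"
      by (simp add: bounded_bloch_operator_def)
    then obtain M where "0 \<le> M"
      "\<And>x. 0 \<le> x \<Longrightarrow> x < 1 \<Longrightarrow> measure \<mu> {x..<1} \<le> M * (1 - x) powr (\<alpha> + 1 - \<beta>)"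
      using tail_bound_if_bounded_cesaro_like[of \<alpha> \<beta>] assms(3-5) by (metis less_eq_real_def less_trans zero_less_one)
    then show "\<exists>M\<ge>0. \<forall>x. 0 \<le> x \<longrightarrow> x < 1 \<longrightarrow> measure \<mu> {x..<1} \<le> M * (1 - x) powr (\<alpha> + 1 - \<beta>)"
      by blast
  next
    assume "\<exists>M\<ge>0. \<forall>x. 0 \<le> x \<longrightarrow> x < 1 \<longrightarrow> measure \<mu> {x..<1} \<le> M * (1 - x) powr (\<alpha> + 1 - \<beta>)"
    then show "bounded_bloch_operator \<alpha> \<beta> (cesaro_like \<mu>)"
      using bounded_cesaro_like_if_tail_bound assms(3-5) by blast
  qed
qed

end
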